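(* Let $n\ge3$ and let $U(C_n,T_m)$ be the signed unicyclic graph obtained from a signed cycle $C_n$ and a signed tree $T_m$ on $m$ vertices by adding an edge between the root vertex of $T_m$ and a vertex $v$ of $C_n$. Let $\delta=1$ if $C_n$ is balanced and $\delta=-1$ otherwise. Then: (i) if $n$ is even and $T_m$ has no perfect matching, $\det U(C_n,T_m)=0$; (ii) if $n$ is even and $T_m$ has a perfect matching, $\det U(C_n,T_m)=(-1)^{m/2}\big(-2\delta+2(-1)^{n/2}\big)$; (iii) if $n$ is odd and $\{T_m,v\}$ has a perfect matching, $\det U(C_n,T_m)=(-1)^{(m+n)/2}$; (iv) if $n$ is odd and $T_m$ has a perfect matching, $\det U(C_n,T_m)=2\delta(-1)^{m/2}$.
   Context: A signed graph has edge weights in $\{1,-1\}$; its determinant is the determinant of its adjacency matrix (entry $=$ weight of the edge, $0$ for non-adjacent pairs and on the diagonal). A signed cycle is balanced if the product of its edge weights is positive. $\{T_m,v\}$ denotes the subgraph of $U(C_n,T_m)$ induced by the vertices of $T_m$ together with $v$. *)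

theory Defs
  imports "Jordan_Normal_Form.Determinant"
begin

record 'a sgraph =
  verts :: "'a set"
  edges :: "'a set set"
  weight :: "'a set \<Rightarrow> real"

definition signed_graph :: "'a sgraph \<Rightarrow> bool" where
  "signed_graph G \<longleftrightarrow> finite (verts G) \<and>
     (\<forall>e\<in>edges G. e \<subseteq> verts G \<and> card e = 2 \<and> weight G e \<in> {1, -1})"

text \<open>The matrix is indexed by positions in a list \<open>vs\<close> enumerating the vertices. Diagonal entries
  vanish in a signed graph, since \<open>{u, u}\<close> has one element and hence is not an edge.\<close>

definition adjacency_matrix :: "'a list \<Rightarrow> 'a sgraph \<Rightarrow> real mat" where
  "adjacency_matrix vs G = mat (length vs) (length vs)
     (\<lambda>(i, j). if {vs ! i, vs ! j} \<in> edges G then weight G {vs ! i, vs ! j} else 0)"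

definition cycle_edges :: "'a list \<Rightarrow> 'a set set" where
  "cycle_edges c = {{c ! i, c ! (Suc i mod length c)} | i. i < length c}"

definition signed_cycle :: "'a sgraph \<Rightarrow> bool" where
  "signed_cycle G \<longleftrightarrow> signed_graph G \<and>
     (\<exists>c. distinct c \<and> length c \<ge> 3 \<and> verts G = set c \<and> edges G = cycle_edges c)"

definition balanced :: "'a sgraph \<Rightarrow> bool" where
  "balanced G \<longleftrightarrow> (\<Prod>e\<in>edges G. weight G e) > 0"

definition connected_graph :: "'a sgraph \<Rightarrow> bool" where
  "connected_graph G \<longleftrightarrow> verts G \<noteq> {} \<and>
     (\<forall>x\<in>verts G. \<forall>y\<in>verts G. (x, y) \<in> {(a, b). {a, b} \<in> edges G}\<^sup>*)"

definition acyclic_graph :: "'a sgraph \<Rightarrow> bool" where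
  "acyclic_graph G \<longleftrightarrow> \<not> (\<exists>c. distinct c \<and> length c \<ge> 3 \<and> cycle_edges c \<subseteq> edges G)"

definition signed_tree :: "'a sgraph \<Rightarrow> bool" where
  "signed_tree G \<longleftrightarrow> signed_graph G \<and> connected_graph G \<and> acyclic_graph G"

definition has_perfect_matching :: "'a sgraph \<Rightarrow> bool" where
  "has_perfect_matching G \<longleftrightarrow> (\<exists>M \<subseteq> edges G. \<forall>x\<in>verts G. \<exists>!e. e \<in> M \<and> x \<in> e)"

definition induced :: "'a sgraph \<Rightarrow> 'a set \<Rightarrow> 'a sgraph" where
  "induced G S = \<lparr>verts = verts G \<inter> S, edges = {e \<in> edges G. e \<subseteq> S}, weight = weight G\<rparr>"

text \<open>\<open>join_by_edge C v T r s\<close> is the disjoint union of \<open>C\<close> and \<open>T\<close> with an extra edge of weight \<open>s\<close>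
  between \<open>v\<close> in \<open>C\<close> and \<open>r\<close> in \<open>T\<close>; it is meaningful only if the vertex sets are disjoint.\<close>

definition join_by_edge :: "'a sgraph \<Rightarrow> 'a \<Rightarrow> 'a sgraph \<Rightarrow> 'a \<Rightarrow> real \<Rightarrow> 'a sgraph" where
  "join_by_edge C v T r s =
     \<lparr>verts = verts C \<union> verts T,
      edges = insert {v, r} (edges C \<union> edges T),
      weight = (\<lambda>e. if e = {v, r} then s else if e \<in> edges C then weight C e else weight T e)\<rparr>"

end

theory Submission
  imports Defs "HOL-Combinatorics.Cycles"
begin

text \<open>In the Leibniz expansion of \<open>det U\<close>, a permutation with a nonzero term that uses the bridge \<open>{v, r}\<close>
  must exchange \<open>v\<close> and \<open>r\<close>, so \<open>det U = det C * det T - det (C - v) * det (T - r)\<close>. Splitting off a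
  pendant vertex is the special case of a one-vertex side; repeating it, a signed forest on \<open>k\<close> vertices has
  determinant \<open>(-1) ^ (k div 2)\<close> or \<open>0\<close> according to whether it has a perfect matching. For a
  cycle through \<open>v\<close>, a permutation with a nonzero term either exchanges \<open>v\<close> with one of its two
  neighbours, leaving a path on \<open>n - 2\<close> vertices, or is one of the two rotations, each
  contributing \<open>(-1) ^ (n - 1) * \<delta>\<close>. Finally, \<open>{T, v}\<close> has a perfect matching iff \<open>T - r\<close> does.\<close>

section \<open>Determinants indexed by finite sets\<close>

definition perm_term :: "'a set \<Rightarrow> ('a \<Rightarrow> 'a \<Rightarrow> real) \<Rightarrow> ('a \<Rightarrow> 'a) \<Rightarrow> real" where
  "perm_term S A p = of_int (sign p) * (\<Prod>i\<in>S. A i (p i))"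

text \<open>Rows and columns are labelled by vertices, so deleting vertices only shrinks
  \<open>S\<close> and no renumbering of positions is ever needed.\<close>

definition set_det :: "'a set \<Rightarrow> ('a \<Rightarrow> 'a \<Rightarrow> real) \<Rightarrow> real" where
  "set_det S A = (\<Sum>p | p permutes S. perm_term S A p)"

lemma set_det_empty [simp]: "set_det {} A = 1"
  by (simp add: set_det_def perm_term_def)

lemma set_det_singleton [simp]: "set_det {x} A = A x x"
  by (simp add: set_det_def perm_term_def)

lemma perm_term_cong:
  assumes "p permutes S" "\<And>x y. x \<in> S \<Longrightarrow> y \<in> S \<Longrightarrow> A x y = B x y"
  shows "perm_term S A p = perm_term S B p"
  using assms by (auto simp: perm_term_def permutes_in_image intro!: prod.cong)

lemma set_det_cong:
  assumes "S = T" "\<And>x y. x \<in> T \<Longrightarrow> y \<in> T \<Longrightarrow> A x y = B x y"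
  shows "set_det S A = set_det T B"
  unfolding set_det_def using assms by (auto intro!: sum.cong perm_term_cong)

lemma perm_term_nonzero:
  assumes "finite S" "perm_term S A p \<noteq> 0" "x \<in> S"
  shows "A x (p x) \<noteq> 0"
  using assms by (auto simp: perm_term_def)

lemma perm_term_zero: "finite S \<Longrightarrow> x \<in> S \<Longrightarrow> A x (p x) = 0 \<Longrightarrow> perm_term S A p = 0"
  using perm_term_nonzero by metis

lemma set_det_zero_row:
  assumes "finite S" "x \<in> S" "\<And>y. y \<in> S \<Longrightarrow> A x y = 0"
  shows "set_det S A = 0"
  unfolding set_det_def
  using assms by (intro sum.neutral) (auto simp: permutes_in_image intro: perm_term_zero[of S x])

text \<open>Conjugation with the enumeration \<open>i \<mapsto> vs ! i\<close> is a bijection from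
  permutations of positions to permutations of vertices; it keeps the sign and reindexes the
  product.\<close>

lemma det_mat_eq_set_det:
  fixes A :: "'a \<Rightarrow> 'a \<Rightarrow> real"
  assumes "distinct vs"
  shows "det (mat (length vs) (length vs) (\<lambda>(i, j). A (vs ! i) (vs ! j))) = set_det (set vs) A"
proof -
  let ?n = "length vs" and ?N = "{0..<length vs}"
  let ?g = "inv_into ?N ((!) vs)"
  have bij: "bij_betw ((!) vs) ?N (set vs)"
    using assms bij_betw_nth by (metis atLeast0LessThan)
  have bij': "bij_betw ?g (set vs) ?N"
    using bij by (rule bij_betw_inv_into)
  have inj: "inj_on ((!) vs) ?N"
    using bij by (simp add: bij_betw_def)
  have term_eq: "perm_term (set vs) A (map_permutation ?N ((!) vs) p) =
      of_int (sign p) * (\<Prod>i = 0..<?n. A (vs ! i) (vs ! p i))" if "p permutes ?N" for p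
  proof -
    have "(\<Prod>x\<in>set vs. A x (map_permutation ?N ((!) vs) p x)) =
        (\<Prod>i\<in>?N. A (vs ! i) (map_permutation ?N ((!) vs) p (vs ! i)))"
      by (rule prod.reindex_bij_betw[OF bij, symmetric])
    also have "\<dots> = (\<Prod>i\<in>?N. A (vs ! i) (vs ! p i))"
      by (intro prod.cong refl) (simp add: map_permutation_apply[OF inj])
    finally show ?thesis
      using sign_map_permutation[OF inj that] by (simp add: perm_term_def)
  qed
  have "det (mat ?n ?n (\<lambda>(i, j). A (vs ! i) (vs ! j))) =
      (\<Sum>p | p permutes ?N. of_int (sign p) * (\<Prod>i = 0..<?n. A (vs ! i) (vs ! p i)))"
    by (subst det_def'[of _ ?n]) (auto simp: permutes_in_image intro!: sum.cong prod.cong)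
  also have "\<dots> = set_det (set vs) A"
    unfolding set_det_def
  proof (rule sum.reindex_bij_witness[of _ "map_permutation (set vs) ?g" "map_permutation ?N ((!) vs)"])
    fix p assume p: "p \<in> {p. p permutes ?N}"
    show "map_permutation (set vs) ?g (map_permutation ?N ((!) vs) p) = p"
      using p bij by (intro map_permutation_compose_inv) (auto simp: inj)
    show "map_permutation ?N ((!) vs) p \<in> {p. p permutes set vs}"
      using p map_permutation_permutes[OF bij] by simp
    show "perm_term (set vs) A (map_permutation ?N ((!) vs) p) =
      of_int (sign p) * (\<Prod>i = 0..<?n. A (vs ! i) (vs ! p i))"
      using term_eq p by simp
  next
    fix q assume q: "q \<in> {p. p permutes set vs}"
    show "map_permutation ?N ((!) vs) (map_permutation (set vs) ?g q) = q"
      using q bij bij' by (intro map_permutation_compose_inv) (auto simp: f_inv_into_f bij_betw_def)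
    show "map_permutation (set vs) ?g q \<in> {p. p permutes ?N}"
      using q map_permutation_permutes[OF bij'] by simp
  qed
  finally show ?thesis .
qed

text \<open>Listing \<open>S\<close> before \<open>T\<close> makes the matrix block triangular, with
  the zero block at the upper right.\<close>

lemma set_det_block:
  assumes "finite S" "finite T" "S \<inter> T = {}"
    and zero: "\<And>x y. x \<in> S \<Longrightarrow> y \<in> T \<Longrightarrow> A x y = 0"
  shows "set_det (S \<union> T) A = set_det S A * set_det T A"
proof -
  obtain xs ys where xs: "set xs = S" "distinct xs" and ys: "set ys = T" "distinct ys"
    using assms finite_distinct_list by metis
  let ?M = "\<lambda>xs ys. mat (length xs) (length ys) (\<lambda>(i, j). A (xs ! i) (ys ! j))"
  have "?M (xs @ ys) (xs @ ys) =
      four_block_mat (?M xs xs) (0\<^sub>m (length xs) (length ys)) (?M ys xs) (?M ys ys)"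
    using xs ys zero by (intro eq_matI) (auto simp: nth_append)
  then have "det (?M (xs @ ys) (xs @ ys)) = det (?M xs xs) * det (?M ys ys)"
    by (metis det_four_block_mat_upper_right_zero mat_carrier)
  moreover have "distinct (xs @ ys)" using xs ys assms by auto
  ultimately show ?thesis
    using det_mat_eq_set_det[of "xs @ ys" A] det_mat_eq_set_det[of xs A] det_mat_eq_set_det[of ys A] xs ys
    by simp
qed

section \<open>Expansion at swaps, bridges and pendant vertices\<close>

text \<open>The permutations exchanging \<open>u\<close> and \<open>w\<close> are the composites of
  their transposition with a permutation \<open>q\<close> of the remaining vertices. The
  transposition flips the sign, and the two rows at \<open>u\<close> and \<open>w\<close> give the
  factor in front.\<close>

lemma sum_perm_term_swapping:
  assumes "finite S" "u \<in> S" "w \<in> S" "u \<noteq> w"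
  shows "(\<Sum>p | p permutes S \<and> p u = w \<and> p w = u. perm_term S A p) =
    - (A u w * A w u * set_det (S - {u, w}) A)"
proof -
  let ?t = "Transposition.transpose u w" and ?R = "S - {u, w}"
  have t: "?t permutes S" using assms by (simp add: permutes_swap_id)
  have term_eq: "perm_term S A (?t \<circ> q) = - (A u w * A w u * perm_term ?R A q)"
    if q: "q permutes ?R" for q
  proof -
    have fixed: "q u = u" "q w = w" using q by (auto simp: permutes_not_in)
    have "sign (?t \<circ> q) = - sign q"
      using assms q by (subst sign_compose)
        (auto simp: sign_swap_id permutation_swap_id intro: permutes_imp_permutation[of ?R])
    moreover have "(\<Prod>i\<in>?R. A i ((?t \<circ> q) i)) = (\<Prod>i\<in>?R. A i (q i))"
    proof (intro prod.cong refl)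
      fix i assume "i \<in> ?R"
      then have "q i \<in> ?R" using q by (simp add: permutes_in_image del: Diff_iff)
      then show "A i ((?t \<circ> q) i) = A i (q i)" by (simp add: transpose_def)
    qed
    moreover have "(\<Prod>i\<in>S. A i ((?t \<circ> q) i)) = A u w * A w u * (\<Prod>i\<in>?R. A i ((?t \<circ> q) i))"
    proof -
      have "S = insert u (insert w ?R)" using assms by auto
      then have "(\<Prod>i\<in>S. A i ((?t \<circ> q) i)) = (\<Prod>i\<in>insert u (insert w ?R). A i ((?t \<circ> q) i))" by simp
      also have "\<dots> = A u w * A w u * (\<Prod>i\<in>?R. A i ((?t \<circ> q) i))"
        using assms fixed by (simp add: mult.assoc)
      finally show ?thesis .
    qed
    ultimately show ?thesis by (simp add: perm_term_def)
  qed
  have "(\<Sum>p | p permutes S \<and> p u = w \<and> p w = u. perm_term S A p) =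
      (\<Sum>q | q permutes ?R. - (A u w * A w u * perm_term ?R A q))"
  proof (rule sum.reindex_bij_witness[of _ "\<lambda>q. ?t \<circ> q" "\<lambda>p. ?t \<circ> p"])
    fix p assume p: "p \<in> {p. p permutes S \<and> p u = w \<and> p w = u}"
    show cancel: "?t \<circ> (?t \<circ> p) = p" by (simp add: comp_assoc[symmetric])
    show mem: "?t \<circ> p \<in> {q. q permutes ?R}"
      using p t by (auto intro: permutes_superset[OF permutes_compose])
    show "- (A u w * A w u * perm_term ?R A (?t \<circ> p)) = perm_term S A p"
      using term_eq[of "?t \<circ> p"] mem cancel by simp
  next
    fix q assume "q \<in> {q. q permutes ?R}"
    then have q: "q permutes ?R" by simp
    show "?t \<circ> (?t \<circ> q) = q" by (simp add: comp_assoc[symmetric])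
    have "q permutes S" using q by (rule permutes_subset) auto
    then show "?t \<circ> q \<in> {p. p permutes S \<and> p u = w \<and> p w = u}"
      using t q by (auto simp: permutes_not_in intro: permutes_compose)
  qed
  also have "\<dots> = - (A u w * A w u * set_det ?R A)"
    by (simp add: set_det_def sum_negf sum_distrib_left)
  finally show ?thesis .
qed

text \<open>Let \<open>B\<close> be \<open>A\<close> with the two bridge entries set to zero, which
  decouples the two sides. Permutations exchanging \<open>v\<close> and \<open>r\<close> give the
  subtracted term; on all others \<open>A\<close> and \<open>B\<close> have equal Leibniz terms, so
  these sum to the determinant of \<open>B\<close>.\<close>

lemma set_det_bridge:
  assumes fin: "finite S" "finite T" and disj: "S \<inter> T = {}" and vr: "v \<in> S" "r \<in> T"
    and zero: "\<And>x y. x \<in> S \<Longrightarrow> y \<in> T \<Longrightarrow> x \<noteq> v \<or> y \<noteq> r \<Longrightarrow> A x y = 0 \<and> A y x = 0"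
  shows "set_det (S \<union> T) A =
    set_det S A * set_det T A - A v r * A r v * (set_det (S - {v}) A * set_det (T - {r}) A)"
proof -
  define B where "B x y = (if x = v \<and> y = r \<or> x = r \<and> y = v then 0 else A x y)" for x y
  let ?V = "S \<union> T"
  let ?P = "{p. p permutes ?V}" and ?Q = "{p. p permutes ?V \<and> p v = r \<and> p r = v}"
  have finV: "finite ?V" using fin by simp
  have finP: "finite ?P" using finV by (rule finite_permutations)
  \<comment> \<open>If \<open>p\<close> crosses from \<open>x\<close> to \<open>y\<close>, it must
    come straight back. The only way from \<open>Y\<close> to \<open>X\<close> leads from
    \<open>y\<close> to \<open>x\<close>; if \<open>p\<close> avoided it, \<open>p\<close> would map
    the finite set \<open>Y\<close> into, hence onto, itself, and \<open>y\<close> would have a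
    second preimage besides \<open>x\<close>. Stated for arbitrary sides so that it serves both
    directions.\<close>
  have return: "p y = x" if p: "p permutes ?V" and nz: "perm_term ?V A p \<noteq> 0"
      and X: "X \<union> Y = ?V" "X \<inter> Y = {}" "x \<in> X" "y \<in> Y" "p x = y"
      and XY: "\<And>a b. a \<in> Y \<Longrightarrow> b \<in> X \<Longrightarrow> a \<noteq> y \<or> b \<noteq> x \<Longrightarrow> A a b = 0" for p X Y x y
  proof (rule ccontr)
    assume "p y \<noteq> x"
    then have "p ` Y \<subseteq> Y"
      using perm_term_nonzero[OF finV nz] XY X(1) p permutes_in_image[OF p] by blast
    moreover have "finite Y" using X(1) finV by (metis finite_Un)
    ultimately have "p ` Y = Y"
      using permutes_inj_on[OF p] by (metis endo_inj_surj)
    then obtain z where "z \<in> Y" "p z = y" using X by (metis imageE)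
    then show False using X p by (metis disjoint_iff permutes_def)
  qed
  have Q_zero: "perm_term ?V B p = 0" if "p \<in> ?Q" for p
    using that vr perm_term_zero[OF finV, of v B p] by (simp add: B_def)
  have notQ: "perm_term ?V A p = perm_term ?V B p" if "p \<in> ?P - ?Q" for p
  proof (cases "p v = r \<or> p r = v")
    case True
    have "perm_term ?V A p = 0"
    proof (rule ccontr)
      assume nz: "perm_term ?V A p \<noteq> 0"
      have p: "p permutes ?V" using that by simp
      show False
      proof (cases "p v = r")
        case True
        then have "p r = v"
          using return[OF p nz, of S T v r] zero vr disj by blast
        then show False using True that by simp
      next
        case False
        with True have "p r = v" by simp
        then have "p v = r"
          using return[OF p nz, of T S r v] zero vr disj by blast
        then show False using False by simp
      qed
    qed
    moreover have "perm_term ?V B p = 0"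
      using True vr perm_term_zero[OF finV, of v B p] perm_term_zero[OF finV, of r B p]
      by (auto simp: B_def)
    ultimately show ?thesis by simp
  next
    case False
    then show ?thesis unfolding perm_term_def B_def
      by (intro arg_cong2[of _ _ _ _ "(*)"] prod.cong) auto
  qed
  have "set_det ?V A = (\<Sum>p\<in>?Q. perm_term ?V A p) + (\<Sum>p\<in>?P - ?Q. perm_term ?V A p)"
    unfolding set_det_def using finP by (subst sum.subset_diff[of ?Q]) auto
  also have "(\<Sum>p\<in>?P - ?Q. perm_term ?V A p) = (\<Sum>p\<in>?P - ?Q. perm_term ?V B p)"
    using notQ by (intro sum.cong) auto
  \<comment> \<open>The exchanging permutations have zero \<open>B\<close>-term, so the sum may be
    extended by them.\<close>
  also have "\<dots> = set_det ?V B"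
    unfolding set_det_def using finP Q_zero by (intro sum.mono_neutral_left) auto
  also have "\<dots> = set_det S B * set_det T B"
    using fin disj zero by (intro set_det_block) (auto simp: B_def)
  also have "set_det S B = set_det S A"
    using disj vr by (intro set_det_cong) (auto simp: B_def)
  also have "set_det T B = set_det T A"
    using disj vr by (intro set_det_cong) (auto simp: B_def)
  also have "(\<Sum>p\<in>?Q. perm_term ?V A p) = - (A v r * A r v * set_det (?V - {v, r}) A)"
    using fin vr disj by (intro sum_perm_term_swapping) auto
  also have "?V - {v, r} = (S - {v}) \<union> (T - {r})"
    using vr disj by auto
  also have "set_det \<dots> A = set_det (S - {v}) A * set_det (T - {r}) A"
    using fin disj zero by (intro set_det_block) auto
  finally show ?thesis by simp
qed

text \<open>A bridge with the single vertex \<open>u\<close> on one side: the first product vanishes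
  because \<open>A u u = 0\<close>, and removing \<open>u\<close> from its side leaves the empty
  determinant 1.\<close>

corollary set_det_pendant:
  assumes "finite S" "u \<in> S" "w \<in> S" "u \<noteq> w" "A u u = 0"
    and "\<And>x. x \<in> S \<Longrightarrow> x \<noteq> w \<Longrightarrow> A u x = 0 \<and> A x u = 0"
  shows "set_det S A = - (A u w * A w u * set_det (S - {u, w}) A)"
proof -
  have "set_det ({u} \<union> (S - {u})) A = - (A u w * A w u * set_det (S - {u} - {w}) A)"
    using assms by (subst set_det_bridge[where v = u and r = w]) auto
  moreover have "{u} \<union> (S - {u}) = S" "S - {u} - {w} = S - {u, w}" using assms by auto
  ultimately show ?thesis by metis
qed

section \<open>Determinants of paths and cycles\<close>

text \<open>Reindexing the product along \<open>p\<close> turns the factors into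
  \<open>A (p i) i\<close>, which symmetry turns into \<open>A i (p i)\<close>.\<close>

lemma perm_term_inv:
  assumes "finite S" "p permutes S" and sym: "\<And>x y. x \<in> S \<Longrightarrow> y \<in> S \<Longrightarrow> A x y = A y x"
  shows "perm_term S A (Hilbert_Choice.inv p) = perm_term S A p"
proof -
  have "(\<Prod>i\<in>S. A i (Hilbert_Choice.inv p i)) = (\<Prod>i\<in>S. A (p i) (Hilbert_Choice.inv p (p i)))"
    using assms(2) by (rule prod.reindex_bij_betw[OF permutes_imp_bij, symmetric])
  also have "\<dots> = (\<Prod>i\<in>S. A i (p i))"
    using assms(2) sym by (intro prod.cong) (auto simp: permutes_inverses permutes_in_image)
  finally show ?thesis
    using assms by (simp add: perm_term_def sign_inverse permutes_imp_permutation)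
qed

text \<open>The first vertex is pendant at the second. Removing such pairs costs a factor -1 each,
  until nothing is left or a single vertex, whose diagonal entry is 0 by the vanishing hypothesis at
  \<open>i = j\<close>.\<close>

lemma set_det_path:
  assumes "distinct xs"
    and "\<And>i j. i < length xs \<Longrightarrow> j < length xs \<Longrightarrow> j \<noteq> Suc i \<Longrightarrow> i \<noteq> Suc j \<Longrightarrow> A (xs ! i) (xs ! j) = 0"
    and "\<And>i. Suc i < length xs \<Longrightarrow> A (xs ! i) (xs ! Suc i) * A (xs ! Suc i) (xs ! i) = 1"
  shows "set_det (set xs) A = (if even (length xs) then (-1) ^ (length xs div 2) else 0)"
  using assms
proof (induction xs rule: induct_list012)
  case 1
  then show ?case by simp
next
  case (2 x)
  from "2.prems"(2)[of 0 0] show ?case by simp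
next
  case (3 x y zs)
  have far: "A x (zs ! j) = 0 \<and> A (zs ! j) x = 0" if "j < length zs" for j
    using that "3.prems"(2)[of 0 "Suc (Suc j)"] "3.prems"(2)[of "Suc (Suc j)" 0] by simp
  have loop: "A x x = 0" using "3.prems"(2)[of 0 0] by simp
  have xy: "A x y * A y x = 1" using "3.prems"(3)[of 0] by simp
  have "set_det (set (x # y # zs)) A = - (A x y * A y x * set_det (set (x # y # zs) - {x, y}) A)"
    using "3.prems"(1) far loop by (intro set_det_pendant) (auto simp: in_set_conv_nth)
  also have "set (x # y # zs) - {x, y} = set zs" using "3.prems"(1) by auto
  also have "set_det (set zs) A = (if even (length zs) then (-1) ^ (length zs div 2) else 0)"
  proof (rule "3.IH"(1))
    show "distinct zs" using "3.prems"(1) by simp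
    show "A (zs ! i) (zs ! j) = 0"
      if "i < length zs" "j < length zs" "j \<noteq> Suc i" "i \<noteq> Suc j" for i j
      using that "3.prems"(2)[of "Suc (Suc i)" "Suc (Suc j)"] by simp
    show "A (zs ! i) (zs ! Suc i) * A (zs ! Suc i) (zs ! i) = 1" if "Suc i < length zs" for i
      using that "3.prems"(3)[of "Suc (Suc i)"] by simp
  qed
  finally show ?case using xy by simp
qed

section \<open>Rotations of a cyclic list\<close>

lemma cycle_of_list_nth:
  assumes "distinct c" "i < length c"
  shows "cycle_of_list c (c ! i) = c ! (Suc i mod length c)"
proof -
  have "map (cycle_of_list c) c ! i = rotate1 c ! i"
    using cyclic_rotation[OF assms(1), of 1] by simp
  then show ?thesis using assms(2) by (simp add: nth_rotate1)
qed

text \<open>Each step in the recursion of \<open>cycle_of_list\<close> composes with one more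
  transposition.\<close>

lemma sign_cycle_of_list:
  "distinct c \<Longrightarrow> sign (cycle_of_list c) = (-1) ^ (length c - 1)"
  by (induction c rule: cycle_of_list.induct)
    (auto simp: sign_compose permutation_swap_id permutation_of_cycle sign_swap_id)

text \<open>Separates the two directions on a cycle; for \<open>n = 2\<close> the forward and the
  backward neighbour would coincide.\<close>

lemma mod_Suc_Suc_neq:
  assumes "i < n" "n \<ge> 3"
  shows "Suc (Suc i mod n) mod n \<noteq> i"
  using assms by (auto simp: mod_Suc)

lemma mod_Suc_inj:
  assumes "Suc i mod n = Suc j mod n" "i < n" "j < n"
  shows "i = j"
  using assms by (auto simp: mod_Suc split: if_splits)

text \<open>Once a permutation moving every vertex of the cycle to a neighbour takes a step forward without
  going straight back, injectivity forces it forward at every vertex.\<close>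

lemma permutes_eq_cycle_of_list:
  assumes c: "distinct c" "length c \<ge> 3" and q: "q permutes set c"
    and nbr: "\<And>i. i < length c \<Longrightarrow>
      \<exists>j < length c. q (c ! i) = c ! j \<and> (j = Suc i mod length c \<or> i = Suc j mod length c)"
    and k: "k < length c" "q (c ! k) = c ! (Suc k mod length c)" "q (c ! (Suc k mod length c)) \<noteq> c ! k"
  shows "q = cycle_of_list c"
proof -
  let ?n = "length c"
  have n: "0 < ?n" using c by linarith
  \<comment> \<open>The second conjunct strengthens the induction: it is what excludes a backward
    move at the following vertex.\<close>
  have forward: "q (c ! ((k + d) mod ?n)) = c ! (Suc ((k + d) mod ?n) mod ?n) \<and>
      q (c ! (Suc ((k + d) mod ?n) mod ?n)) \<noteq> c ! ((k + d) mod ?n)" for d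
  proof (induction d)
    case 0
    then show ?case using k by simp
  next
    case (Suc d)
    define i where "i = (k + d) mod ?n"
    define i' where "i' = Suc i mod ?n"
    have i: "i < ?n" "i' < ?n" using n by (auto simp: i_def i'_def)
    have i': "(k + Suc d) mod ?n = i'" by (simp add: i_def i'_def mod_Suc_eq)
    have IH: "q (c ! i) = c ! i'" "q (c ! i') \<noteq> c ! i"
      using Suc.IH by (auto simp: i_def i'_def)
    obtain j where j: "j < ?n" "q (c ! i') = c ! j" "j = Suc i' mod ?n \<or> i' = Suc j mod ?n"
      using nbr[OF i(2)] by blast
    have "j = Suc i' mod ?n"
      using j IH(2) mod_Suc_inj[of i ?n j] i by (auto simp: i'_def)
    \<comment> \<open>The value \<open>c ! i'\<close> is already taken at \<open>c ! i\<close>, so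
      by injectivity two forward steps from \<open>i\<close> would return to
      \<open>i\<close>.\<close>
    moreover have "q (c ! (Suc i' mod ?n)) \<noteq> c ! i'"
    proof
      assume "q (c ! (Suc i' mod ?n)) = c ! i'"
      then have "c ! (Suc i' mod ?n) = c ! i"
        using IH(1) permutes_inj[OF q] by (metis injD)
      then have "Suc i' mod ?n = i"
        using c i n by (simp add: nth_eq_iff_index_eq)
      then show False using mod_Suc_Suc_neq i c by (metis i'_def)
    qed
    ultimately show ?case using j(2) unfolding i' by blast
  qed
  show ?thesis
  proof
    fix x
    show "q x = cycle_of_list c x"
    proof (cases "x \<in> set c")
      case True
      then obtain i where i: "i < ?n" "x = c ! i" by (metis in_set_conv_nth)
      \<comment> \<open>Position \<open>i\<close> is reached from \<open>k\<close> by completing the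
        turn to 0 and then advancing \<open>i\<close> steps.\<close>
      have "(k + (?n - k + i)) mod ?n = i" using k i by simp
      then show ?thesis using forward[of "?n - k + i"] i c by (simp add: cycle_of_list_nth)
    next
      case False
      then show ?thesis using q by (simp add: permutes_not_in id_outside_supp)
    qed
  qed
qed

text \<open>The first summand comes from the two rotations, whose terms agree by symmetry; the
  second comes from the swaps of \<open>c ! 0\<close> with its two neighbours, each leaving a path
  on \<open>length c - 2\<close> vertices.\<close>

lemma set_det_cycle:
  assumes c: "distinct c" "length c \<ge> 3"
    and sym: "\<And>x y. A x y = A y x"
    and zero: "\<And>i j. i < length c \<Longrightarrow> j < length c \<Longrightarrow> j \<noteq> Suc i mod length c \<Longrightarrow>
      i \<noteq> Suc j mod length c \<Longrightarrow> A (c ! i) (c ! j) = 0"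
    and unit: "\<And>i. i < length c \<Longrightarrow>
      A (c ! i) (c ! (Suc i mod length c)) * A (c ! i) (c ! (Suc i mod length c)) = 1"
  shows "set_det (set c) A =
    2 * (-1) ^ (length c - 1) * (\<Prod>i<length c. A (c ! i) (c ! (Suc i mod length c))) +
    (if even (length c) then 2 * (-1) ^ (length c div 2) else 0)"
proof -
  let ?n = "length c" and ?S = "set c" and ?\<rho> = "cycle_of_list c"
  \<comment> \<open>\<open>x\<close> and \<open>y\<close> are the forward and the backward neighbour
    of the base vertex \<open>v\<close>.\<close>
  define v x y where "v = c ! 0" and "x = c ! 1" and "y = c ! (?n - 1)"
  let ?P = "{p. p permutes ?S}"
  let ?Q = "\<lambda>w. {p. p permutes ?S \<and> p v = w \<and> p w = v}"
  have ne: "c \<noteq> []" using c by auto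
  have step: "A (c ! i) (c ! Suc i) * A (c ! Suc i) (c ! i) = 1" if "Suc i < ?n" for i
    using that unit[of i] sym[of "c ! Suc i" "c ! i"] by simp
  have mem: "v \<in> ?S" "x \<in> ?S" "y \<in> ?S" and neq: "v \<noteq> x" "v \<noteq> y" "x \<noteq> y"
    using c ne by (auto simp: v_def x_def y_def nth_eq_iff_index_eq)
  have \<rho>: "?\<rho> permutes ?S" by (rule cycle_permutes)
  have \<rho>_v: "?\<rho> v = x"
    using c ne cycle_of_list_nth[of c 0] by (simp add: v_def x_def)
  have "?\<rho> x = c ! 2"
    using c ne cycle_of_list_nth[of c 1] by (simp add: x_def numeral_2_eq_2)
  then have \<rho>_x: "?\<rho> x \<noteq> v"
    using c ne by (simp add: v_def nth_eq_iff_index_eq)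
  have \<rho>_y: "?\<rho> y = v"
    using c ne cycle_of_list_nth[of c "?n - 1"] by (simp add: v_def y_def)
  have inv_v: "Hilbert_Choice.inv ?\<rho> v = y"
    using \<rho> \<rho>_y by (metis permutes_inverses(2))
  have inv_y: "Hilbert_Choice.inv ?\<rho> y \<noteq> v"
    using \<rho> \<rho>_v neq by (metis permutes_inverses(1))
  have finP: "finite ?P" by (simp add: finite_permutations)
  have support: "p \<in> ?Q x \<union> ?Q y \<union> {?\<rho>, Hilbert_Choice.inv ?\<rho>}"
    if p: "p permutes ?S" and nz: "perm_term ?S A p \<noteq> 0" for p
  proof -
    have nbr: "\<exists>j < ?n. p (c ! i) = c ! j \<and> (j = Suc i mod ?n \<or> i = Suc j mod ?n)" if "i < ?n" for i
    proof -
      have "p (c ! i) \<in> set c" using p that by (simp add: permutes_in_image)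
      then obtain j where j: "j < ?n" "p (c ! i) = c ! j" by (metis in_set_conv_nth)
      moreover have "A (c ! i) (p (c ! i)) \<noteq> 0"
        using perm_term_nonzero[OF _ nz, of "c ! i"] that by simp
      ultimately show ?thesis using zero that by metis
    qed
    have nbr': "\<exists>j < ?n. Hilbert_Choice.inv p (c ! i) = c ! j \<and> (j = Suc i mod ?n \<or> i = Suc j mod ?n)"
      if "i < ?n" for i
    proof -
      have "Hilbert_Choice.inv p (c ! i) \<in> set c" using permutes_inv[OF p] that by (simp add: permutes_in_image)
      then obtain j where j: "j < ?n" "Hilbert_Choice.inv p (c ! i) = c ! j" by (metis in_set_conv_nth)
      then have "p (c ! j) = c ! i" using p by (metis permutes_inverses(1))
      then show ?thesis using nbr[OF j(1)] j that c by (auto simp: nth_eq_iff_index_eq)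
    qed
    obtain j where j: "j < ?n" "p v = c ! j" "j = Suc 0 mod ?n \<or> 0 = Suc j mod ?n"
      using nbr[of 0] c ne by (auto simp: v_def)
    have "j = 1 \<or> j = ?n - 1"
      using j c by (auto simp: mod_Suc split: if_splits)
    then consider "p v = x" | "p v = y" using j by (auto simp: x_def y_def)
    then show ?thesis
    proof cases
      case 1
      show ?thesis
      proof (cases "p x = v")
        case True
        then show ?thesis using 1 p by simp
      next
        case False
        then have "p = ?\<rho>"
          using c ne p nbr 1 by (intro permutes_eq_cycle_of_list[where k = 0]) (auto simp: v_def x_def)
        then show ?thesis by simp
      qed
    next
      case 2
      show ?thesis
      proof (cases "p y = v")
        case True
        then show ?thesis using 2 p by simp
      next
        case False
        \<comment> \<open>A backward move of \<open>p\<close> at \<open>v\<close> is a forward move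
          of its inverse at \<open>y\<close>, the last position. So the forward criterion applies to
          the inverse.\<close>
        have "Hilbert_Choice.inv p y = v" "Hilbert_Choice.inv p v \<noteq> y"
          using 2 False p by (metis permutes_inverses)+
        then have "Hilbert_Choice.inv p = ?\<rho>"
          using c ne permutes_inv[OF p] nbr'
          by (intro permutes_eq_cycle_of_list[where k = "?n - 1"]) (auto simp: v_def y_def)
        then have "p = Hilbert_Choice.inv ?\<rho>" using p by (metis inv_inv_eq permutes_bij)
        then show ?thesis by simp
      qed
    qed
  qed
  have "set_det ?S A = (\<Sum>p \<in> ?Q x \<union> ?Q y \<union> {?\<rho>, Hilbert_Choice.inv ?\<rho>}. perm_term ?S A p)"
    unfolding set_det_def
    using finP support \<rho> permutes_inv[OF \<rho>] by (intro sum.mono_neutral_right) auto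
  also have "\<dots> = (\<Sum>p \<in> ?Q x. perm_term ?S A p) + (\<Sum>p \<in> ?Q y. perm_term ?S A p) +
      (perm_term ?S A ?\<rho> + perm_term ?S A (Hilbert_Choice.inv ?\<rho>))"
  proof -
    have fin: "finite (?Q w)" for w using finP by (rule rev_finite_subset) auto
    have "?\<rho> \<noteq> Hilbert_Choice.inv ?\<rho>" using \<rho>_v inv_v neq by metis
    moreover have "(?Q x \<union> ?Q y) \<inter> {?\<rho>, Hilbert_Choice.inv ?\<rho>} = {}"
      using \<rho>_v \<rho>_x inv_v inv_y neq by auto
    moreover have "?Q x \<inter> ?Q y = {}" using neq by auto
    ultimately show ?thesis using fin by (simp add: sum.union_disjoint del: Un_insert_right)
  qed
  also have "(\<Sum>p \<in> ?Q x. perm_term ?S A p) = (if even ?n then (-1) ^ (?n div 2) else 0)"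
  proof -
    have rest: "?S - {v, x} = set (drop 2 c)"
    proof -
      have "c = v # x # drop 2 c"
        using c by (cases c; cases "tl c") (auto simp: v_def x_def)
      then obtain zs where "c = v # x # zs" "drop 2 c = zs" by blast
      then show ?thesis using c(1) by auto
    qed
    have "set_det (set (drop 2 c)) A =
        (if even (length (drop 2 c)) then (-1) ^ (length (drop 2 c) div 2) else 0)"
    proof (rule set_det_path)
      show "distinct (drop 2 c)" using c by simp
      \<comment> \<open>A wrap-around adjacency would involve position 0, which has been
        deleted.\<close>
      show "A (drop 2 c ! i) (drop 2 c ! j) = 0"
        if "i < length (drop 2 c)" "j < length (drop 2 c)" "j \<noteq> Suc i" "i \<noteq> Suc j" for i j
        using that c zero[of "2 + i" "2 + j"] by (auto simp: mod_Suc)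
      show "A (drop 2 c ! i) (drop 2 c ! Suc i) * A (drop 2 c ! Suc i) (drop 2 c ! i) = 1"
        if "Suc i < length (drop 2 c)" for i
        using that step[of "2 + i"] by simp
    qed
    moreover have "A v x * A x v = 1"
      using c step[of 0] by (simp add: v_def x_def)
    \<comment> \<open>The minus sign of the swap is absorbed by raising the exponent by one.\<close>
    moreover have "?n div 2 = Suc ((?n - 2) div 2)" using c by linarith
    ultimately show ?thesis
      using mem neq rest c by (subst sum_perm_term_swapping) auto
  qed
  also have "(\<Sum>p \<in> ?Q y. perm_term ?S A p) = (if even ?n then (-1) ^ (?n div 2) else 0)"
  proof -
    let ?d = "butlast (tl c)"
    have nth_d: "?d ! i = c ! Suc i" if "i < ?n - 2" for i
      using that by (simp add: nth_butlast nth_tl)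
    have rest: "?S - {v, y} = set ?d"
    proof -
      obtain xs where xs: "c = v # xs" using ne by (cases c) (simp_all add: v_def)
      then have "xs \<noteq> []" using c by auto
      moreover have "last c = y" using last_conv_nth[OF ne] by (simp add: y_def)
      ultimately have "xs = butlast xs @ [y]" using xs append_butlast_last_id by fastforce
      then obtain zs where "c = v # zs @ [y]" "?d = zs" using xs by (metis list.sel(3))
      then show ?thesis using c(1) by auto
    qed
    have "set_det (set ?d) A = (if even (length ?d) then (-1) ^ (length ?d div 2) else 0)"
    proof (rule set_det_path)
      show "distinct ?d" using c by (simp add: distinct_butlast distinct_tl)
      show "A (?d ! i) (?d ! j) = 0"
        if "i < length ?d" "j < length ?d" "j \<noteq> Suc i" "i \<noteq> Suc j" for i j
        using that c zero[of "Suc i" "Suc j"] nth_d by (auto simp: mod_Suc)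
      show "A (?d ! i) (?d ! Suc i) * A (?d ! Suc i) (?d ! i) = 1" if "Suc i < length ?d" for i
        using that step[of "Suc i"] nth_d by simp
    qed
    moreover have "A v y * A y v = 1"
      using c ne unit[of "?n - 1"] sym[of v y] by (simp add: v_def y_def)
    moreover have "?n div 2 = Suc ((?n - 2) div 2)" using c by linarith
    moreover have "length ?d = ?n - 2" by simp
    ultimately show ?thesis
      using mem neq rest c by (subst sum_perm_term_swapping) auto
  qed
  also have "perm_term ?S A (Hilbert_Choice.inv ?\<rho>) = perm_term ?S A ?\<rho>"
    using \<rho> sym by (intro perm_term_inv) auto
  also have "perm_term ?S A ?\<rho> = (-1) ^ (?n - 1) * (\<Prod>i<?n. A (c ! i) (c ! (Suc i mod ?n)))"
  proof -
    have "(\<Prod>z\<in>?S. A z (?\<rho> z)) = (\<Prod>i<?n. A (c ! i) (?\<rho> (c ! i)))"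
      using c by (intro prod.reindex_bij_betw[symmetric] bij_betw_nth) auto
    also have "\<dots> = (\<Prod>i<?n. A (c ! i) (c ! (Suc i mod ?n)))"
      using c by (intro prod.cong) (auto simp: cycle_of_list_nth)
    finally show ?thesis using c by (simp add: perm_term_def sign_cycle_of_list)
  qed
  finally show ?thesis by simp
qed

section \<open>Signed forests\<close>

definition adj :: "'a sgraph \<Rightarrow> 'a \<Rightarrow> 'a \<Rightarrow> real" where
  "adj G x y = (if {x, y} \<in> edges G then weight G {x, y} else 0)"

lemma adj_commute: "adj G x y = adj G y x"
  by (simp add: adj_def insert_commute)

lemma det_adjacency_matrix:
  assumes "distinct vs" "set vs = verts G"
  shows "det (adjacency_matrix vs G) = set_det (verts G) (adj G)"
  using det_mat_eq_set_det[OF assms(1), of "adj G"] assms(2)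
  by (simp add: adjacency_matrix_def adj_def)

lemma signed_graph_loopfree:
  assumes "signed_graph G"
  shows "{x, x} \<notin> edges G"
  using assms by (force simp: signed_graph_def)

lemma adj_loop [simp]: "signed_graph G \<Longrightarrow> adj G x x = 0"
  using signed_graph_loopfree[of G x] by (simp add: adj_def)

lemma adj_square:
  assumes "signed_graph G" "{x, y} \<in> edges G"
  shows "adj G x y * adj G x y = 1"
  using assms by (fastforce simp: signed_graph_def adj_def)

lemma induced_simps [simp]:
  "verts (induced G S) = verts G \<inter> S"
  "edges (induced G S) = {e \<in> edges G. e \<subseteq> S}"
  "weight (induced G S) = weight G"
  by (simp_all add: induced_def)

lemma signed_graph_induced: "signed_graph G \<Longrightarrow> signed_graph (induced G S)"
  by (auto simp: signed_graph_def)

lemma acyclic_graph_induced: "acyclic_graph G \<Longrightarrow> acyclic_graph (induced G S)"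
  by (force simp: acyclic_graph_def)

lemma set_det_induced:
  assumes "S \<subseteq> verts G"
  shows "set_det (verts (induced G S)) (adj (induced G S)) = set_det S (adj G)"
  using assms by (intro set_det_cong) (auto simp: adj_def)

text \<open>Serves to compare induced subgraphs of different graphs: their weight functions may
  differ, so they need not be equal as records.\<close>

lemma has_perfect_matching_cong:
  assumes "verts G = verts H" "edges G = edges H"
  shows "has_perfect_matching G = has_perfect_matching H"
  using assms by (simp add: has_perfect_matching_def)

text \<open>The first vertex of a longest path has all its neighbours on the path, and any but the second
  one would close a cycle.\<close>

lemma acyclic_graph_leaf:
  assumes G: "signed_graph G" "acyclic_graph G" and "verts G \<noteq> {}"
    and nbr: "\<And>x. x \<in> verts G \<Longrightarrow> \<exists>e \<in> edges G. x \<in> e"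
  obtains u w where "{u, w} \<in> edges G" "\<And>e. e \<in> edges G \<Longrightarrow> u \<in> e \<Longrightarrow> e = {u, w}"
proof -
  define path where "path xs \<longleftrightarrow> xs \<noteq> [] \<and> distinct xs \<and> set xs \<subseteq> verts G \<and>
    (\<forall>i. Suc i < length xs \<longrightarrow> {xs ! i, xs ! Suc i} \<in> edges G)" for xs
  obtain x where "x \<in> verts G" using assms by auto
  then have "path [x]" by (simp add: path_def)
  \<comment> \<open>Paths repeat no vertex, so their length is bounded and a longest one
    exists.\<close>
  moreover have "length xs < Suc (card (verts G))" if "path xs" for xs
    using that G card_mono[of "verts G" "set xs"]
    by (simp add: path_def signed_graph_def distinct_card)
  ultimately obtain xs where xs: "path xs" and max: "\<And>ys. path ys \<Longrightarrow> length ys \<le> length xs"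
    using ex_has_greatest_nat[of path "[x]" length] by blast
  define u where "u = xs ! 0"
  have step: "\<exists>y. e = {u, y} \<and> Suc 0 < length xs \<and> y = xs ! Suc 0" if e: "e \<in> edges G" "u \<in> e" for e
  proof -
    obtain y where y: "e = {u, y}" "y \<noteq> u" "y \<in> verts G"
      using G e unfolding signed_graph_def card_2_iff by (metis doubleton_eq_iff insert_iff
          insert_subset singletonD)
    have "y \<in> set xs"
    proof (rule ccontr)
      assume "y \<notin> set xs"
      \<comment> \<open>A neighbour of \<open>u\<close> off the path could be put in front of it,
        against maximality.\<close>
      then have "path (y # xs)"
        using xs y e unfolding path_def u_def
        by (auto simp: nth_Cons insert_commute split: nat.split)
      then show False using max by fastforce
    qed
    then obtain j where j: "j < length xs" "y = xs ! j" by (metis in_set_conv_nth)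
    have "j \<noteq> 0" using j y(2) by (metis u_def)
    moreover have "\<not> j \<ge> 2"
    proof
      assume j2: "j \<ge> 2"
      \<comment> \<open>The prefix ending at \<open>y\<close> becomes a cycle through the edge
        \<open>{u, y}\<close>, which is the wrap-around edge at index \<open>j\<close>.\<close>
      let ?c = "take (Suc j) xs"
      have len: "length ?c = Suc j" using j by simp
      have "cycle_edges ?c \<subseteq> edges G"
      proof
        fix f assume "f \<in> cycle_edges ?c"
        then obtain i where i: "i \<le> j" "f = {?c ! i, ?c ! (Suc i mod Suc j)}"
          unfolding cycle_edges_def len by (auto simp: less_Suc_eq_le)
        show "f \<in> edges G"
        proof (cases "i = j")
          case True
          then show ?thesis using i e y j by (simp add: u_def insert_commute)
        next
          case False
          then have "Suc i < length xs" using i j by simp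
          then show ?thesis using i False xs by (simp add: path_def)
        qed
      qed
      moreover have "distinct ?c" "length ?c \<ge> 3" using xs j2 len by (auto simp: path_def)
      ultimately show False using G unfolding acyclic_graph_def by blast
    qed
    ultimately have "j = Suc 0" by simp
    then show ?thesis using y j by blast
  qed
  have "u \<in> verts G" using xs by (auto simp: path_def u_def)
  then obtain e where "e \<in> edges G" "u \<in> e" using nbr by blast
  then have "{u, xs ! Suc 0} \<in> edges G" using step by metis
  then show thesis using that step by metis
qed

text \<open>The vertex \<open>u\<close> can only be covered by \<open>{u, w}\<close>, so every
  perfect matching contains that edge, and removing or adding it passes between matchings of the two
  graphs.\<close>

lemma has_perfect_matching_remove_leaf:
  assumes G: "signed_graph G" and uw: "{u, w} \<in> edges G"
    and leaf: "\<And>e. e \<in> edges G \<Longrightarrow> u \<in> e \<Longrightarrow> e = {u, w}"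
  shows "has_perfect_matching G \<longleftrightarrow> has_perfect_matching (induced G (verts G - {u, w}))"
proof
  have sub: "e \<subseteq> verts G" if "e \<in> edges G" for e
    using G that by (auto simp: signed_graph_def)
  have V: "u \<in> verts G" "w \<in> verts G" using sub[OF uw] by auto
  {
    assume "has_perfect_matching G"
    then obtain M where M: "M \<subseteq> edges G" "\<forall>x\<in>verts G. \<exists>!e. e \<in> M \<and> x \<in> e"
      unfolding has_perfect_matching_def by (elim exE conjE)
    then obtain e where "e \<in> M" "u \<in> e" using V by blast
    then have uwM: "{u, w} \<in> M" using M(1) leaf[of e] by auto
    let ?M = "M - {{u, w}}"
    \<comment> \<open>Both \<open>u\<close> and \<open>w\<close> are covered by
      \<open>{u, w}\<close>, and by uniqueness by no other edge of the matching.\<close>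
    have avoid: "u \<notin> e" "w \<notin> e" if "e \<in> ?M" for e
      using that bspec[OF M(2) V(1)] bspec[OF M(2) V(2)] uwM by (metis Diff_iff insert_iff)+
    have "?M \<subseteq> edges (induced G (verts G - {u, w}))"
    proof
      fix e assume "e \<in> ?M"
      then show "e \<in> edges (induced G (verts G - {u, w}))"
        using avoid[of e] M(1) sub[of e] by auto
    qed
    moreover have "\<exists>!e. e \<in> ?M \<and> x \<in> e" if "x \<in> verts G - {u, w}" for x
      using bspec[OF M(2), of x] that by (metis Diff_iff insert_iff singletonD)
    ultimately show "has_perfect_matching (induced G (verts G - {u, w}))"
      unfolding has_perfect_matching_def by (intro exI[of _ ?M]) simp
  next
    assume "has_perfect_matching (induced G (verts G - {u, w}))"
    then obtain M where M': "M \<subseteq> edges (induced G (verts G - {u, w}))"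
        "\<forall>x\<in>verts (induced G (verts G - {u, w})). \<exists>!e. e \<in> M \<and> x \<in> e"
      unfolding has_perfect_matching_def by (elim exE conjE)
    have M: "M \<subseteq> edges G" "\<And>e. e \<in> M \<Longrightarrow> u \<notin> e \<and> w \<notin> e" using M'(1) by auto
    have "\<exists>!e. e \<in> insert {u, w} M \<and> x \<in> e" if "x \<in> verts G" for x
    proof (cases "x \<in> {u, w}")
      case True
      then show ?thesis using M(2) by blast
    next
      case False
      then have "\<exists>!e. e \<in> M \<and> x \<in> e" using M'(2) that by simp
      then show ?thesis using False by (metis insert_iff)
    qed
    then show "has_perfect_matching G"
      unfolding has_perfect_matching_def using M(1) uw by (intro exI[of _ "insert {u, w} M"]) simp
  }
qed

text \<open>Induction on the number of vertices. Deleting a leaf and its neighbour negates the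
  determinant and preserves the existence of a perfect matching. The statement is about forests
  because the deletion may disconnect a tree. The parity part later excludes that a tree and the
  tree without its root both have perfect matchings.\<close>

lemma set_det_forest:
  assumes "signed_graph G" "acyclic_graph G"
  shows "set_det (verts G) (adj G) =
      (if has_perfect_matching G then (-1) ^ (card (verts G) div 2) else 0) \<and>
    (has_perfect_matching G \<longrightarrow> even (card (verts G)))"
  using assms
proof (induction "card (verts G)" arbitrary: G rule: less_induct)
  case less
  have fin: "finite (verts G)" using less.prems by (simp add: signed_graph_def)
  \<comment> \<open>The empty graph has determinant 1 and the empty matching; an isolated vertex
    gives a zero row and prevents a matching; otherwise a leaf exists.\<close>
  consider "verts G = {}" | x where "x \<in> verts G" "\<And>e. e \<in> edges G \<Longrightarrow> x \<notin> e" |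
      "verts G \<noteq> {}" "\<And>x. x \<in> verts G \<Longrightarrow> \<exists>e \<in> edges G. x \<in> e"
    by blast
  then show ?case
  proof cases
    case 1
    then show ?thesis by (auto simp: has_perfect_matching_def)
  next
    case (2 x)
    then have "\<not> has_perfect_matching G" unfolding has_perfect_matching_def by blast
    moreover have "set_det (verts G) (adj G) = 0"
      using 2 fin by (intro set_det_zero_row[of _ x]) (auto simp: adj_def)
    ultimately show ?thesis by simp
  next
    case 3
    obtain u w where uw: "{u, w} \<in> edges G" and leaf: "\<And>e. e \<in> edges G \<Longrightarrow> u \<in> e \<Longrightarrow> e = {u, w}"
      using acyclic_graph_leaf[OF less.prems 3] by blast
    have V: "u \<in> verts G" "w \<in> verts G" "u \<noteq> w"
      using uw less.prems(1) signed_graph_loopfree[OF less.prems(1)] by (auto simp: signed_graph_def)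
    let ?H = "induced G (verts G - {u, w})"
    have verts_H: "verts ?H = verts G - {u, w}" by auto
    have card: "card (verts G) = card (verts ?H) + 2"
    proof -
      have "verts G = insert u (insert w (verts ?H))" using V by auto
      then have "card (verts G) = card (insert u (insert w (verts ?H)))" by (rule arg_cong)
      then show ?thesis using V fin by simp
    qed
    have zero: "adj G u x = 0 \<and> adj G x u = 0" if "x \<noteq> w" for x
      using that leaf[of "{u, x}"] by (auto simp: adj_def insert_commute[of x u] doubleton_eq_iff)
    have "set_det (verts G) (adj G) =
        - (adj G u w * adj G w u * set_det (verts G - {u, w}) (adj G))"
      using fin V zero less.prems by (intro set_det_pendant) auto
    also have "adj G u w * adj G w u = 1"
      using adj_square[OF less.prems(1) uw] by (simp add: adj_commute[of G w u])
    also have "set_det (verts G - {u, w}) (adj G) = set_det (verts ?H) (adj ?H)"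
      by (rule set_det_induced[symmetric]) auto
    finally have "set_det (verts G) (adj G) = - set_det (verts ?H) (adj ?H)" by simp
    moreover have "has_perfect_matching G \<longleftrightarrow> has_perfect_matching ?H"
      using has_perfect_matching_remove_leaf[OF less.prems(1) uw leaf] .
    ultimately show ?thesis
      using less.hyps[of ?H] card less.prems signed_graph_induced acyclic_graph_induced by auto
  qed
qed

section \<open>Signed cycles and unicyclic graphs\<close>

lemma cycle_edges_rotate_subset:
  assumes "c \<noteq> []"
  shows "cycle_edges (rotate k c) \<subseteq> cycle_edges c"
proof
  let ?n = "length c"
  fix e assume "e \<in> cycle_edges (rotate k c)"
  then obtain i where i: "i < ?n" "e = {rotate k c ! i, rotate k c ! (Suc i mod ?n)}"
    by (auto simp: cycle_edges_def)
  have "e = {c ! ((k + i) mod ?n), c ! (Suc ((k + i) mod ?n) mod ?n)}"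
    using i assms by (simp add: nth_rotate mod_simps)
  moreover have "(k + i) mod ?n < ?n" using assms by simp
  ultimately show "e \<in> cycle_edges c" unfolding cycle_edges_def by blast
qed

text \<open>The reverse inclusion follows by rotating further, by
  \<open>length c - k mod length c\<close>, which completes a full turn.\<close>

lemma cycle_edges_rotate: "cycle_edges (rotate k c) = cycle_edges c"
proof (cases "c = []")
  case False
  let ?n = "length c"
  have "(?n - k mod ?n + k) mod ?n = 0"
    using False by (metis le_add_diff_inverse2 length_greater_0_conv less_imp_le_nat mod_add_right_eq
        mod_less_divisor mod_self)
  then have "rotate (?n - k mod ?n) (rotate k c) = c"
    by (simp add: rotate_rotate rotate_id)
  then have "cycle_edges c \<subseteq> cycle_edges (rotate k c)"
    using cycle_edges_rotate_subset[of "rotate k c" "?n - k mod ?n"] False by simp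
  then show ?thesis using cycle_edges_rotate_subset[OF False] by blast
qed simp

lemma nth_doubleton_in_cycle_edges_iff:
  assumes "distinct c" "i < length c" "j < length c"
  shows "{c ! i, c ! j} \<in> cycle_edges c \<longleftrightarrow> j = Suc i mod length c \<or> i = Suc j mod length c"
proof
  assume "{c ! i, c ! j} \<in> cycle_edges c"
  then obtain k where k: "k < length c" "{c ! i, c ! j} = {c ! k, c ! (Suc k mod length c)}"
    by (auto simp: cycle_edges_def)
  moreover have "Suc k mod length c < length c" using assms by (intro mod_less_divisor) linarith
  ultimately show "j = Suc i mod length c \<or> i = Suc j mod length c"
    using assms by (auto simp: doubleton_eq_iff nth_eq_iff_index_eq)
next
  assume "j = Suc i mod length c \<or> i = Suc j mod length c"
  then show "{c ! i, c ! j} \<in> cycle_edges c"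
    using assms unfolding cycle_edges_def by (auto simp: insert_commute)
qed

lemma signed_cycle_list_from:
  assumes "signed_cycle C" "v \<in> verts C"
  obtains c where "distinct c" "length c \<ge> 3" "c ! 0 = v" "verts C = set c" "edges C = cycle_edges c"
proof -
  obtain c where c: "distinct c" "length c \<ge> 3" "verts C = set c" "edges C = cycle_edges c"
    using assms by (auto simp: signed_cycle_def)
  then obtain k where k: "k < length c" "c ! k = v"
    using assms(2) by (metis in_set_conv_nth)
  have "rotate k c ! 0 = v" using k by (subst nth_rotate) auto
  then show thesis
    using c by (intro that[of "rotate k c"]) (auto simp: cycle_edges_rotate)
qed

text \<open>Distinct positions give distinct edges: otherwise each would be the successor of the
  other, which a length of at least 3 forbids. This relates the product in \<open>balanced\<close>
  to the one in \<open>set_det_cycle\<close>.\<close>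

lemma prod_cycle_edges:
  assumes "distinct c" "length c \<ge> 3"
  shows "(\<Prod>e\<in>cycle_edges c. f e) = (\<Prod>i<length c. f {c ! i, c ! (Suc i mod length c)})"
proof -
  let ?n = "length c"
  have "cycle_edges c = (\<lambda>i. {c ! i, c ! (Suc i mod ?n)}) ` {..<?n}"
    by (auto simp: cycle_edges_def)
  moreover have "inj_on (\<lambda>i. {c ! i, c ! (Suc i mod ?n)}) {..<?n}"
  proof (rule inj_onI)
    fix i j assume ij: "i \<in> {..<?n}" "j \<in> {..<?n}"
      and eq: "{c ! i, c ! (Suc i mod ?n)} = {c ! j, c ! (Suc j mod ?n)}"
    have "Suc i mod ?n < ?n" "Suc j mod ?n < ?n" using ij by (auto intro!: mod_less_divisor)
    then have "i = j \<or> i = Suc j mod ?n \<and> Suc i mod ?n = j"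
      using eq ij assms(1) by (auto simp: doubleton_eq_iff nth_eq_iff_index_eq)
    then show "i = j" using mod_Suc_Suc_neq[of j ?n] ij assms(2) by auto
  qed
  ultimately show ?thesis by (simp add: prod.reindex)
qed

text \<open>The cyclic product of entries is the product of all edge weights. It has absolute value
  1, so balance alone determines it.\<close>

lemma set_det_signed_cycle:
  assumes "signed_cycle C"
  shows "set_det (verts C) (adj C) =
    2 * (-1) ^ (card (verts C) - 1) * (if balanced C then 1 else -1) +
    (if even (card (verts C)) then 2 * (-1) ^ (card (verts C) div 2) else 0)"
proof -
  have G: "signed_graph C" using assms by (simp add: signed_cycle_def)
  obtain c where c: "distinct c" "length c \<ge> 3" "verts C = set c" "edges C = cycle_edges c"
    using assms by (auto simp: signed_cycle_def)
  let ?n = "length c"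
  have edge: "{c ! i, c ! (Suc i mod ?n)} \<in> edges C" if "i < ?n" for i
    using that c by (auto simp: cycle_edges_def)
  have "set_det (set c) (adj C) =
      2 * (-1) ^ (?n - 1) * (\<Prod>i<?n. adj C (c ! i) (c ! (Suc i mod ?n))) +
      (if even ?n then 2 * (-1) ^ (?n div 2) else 0)"
  proof (rule set_det_cycle)
    show "adj C (c ! i) (c ! j) = 0"
      if "i < ?n" "j < ?n" "j \<noteq> Suc i mod ?n" "i \<noteq> Suc j mod ?n" for i j
      using that c by (simp add: adj_def nth_doubleton_in_cycle_edges_iff)
    show "adj C (c ! i) (c ! (Suc i mod ?n)) * adj C (c ! i) (c ! (Suc i mod ?n)) = 1"
      if "i < ?n" for i
      using adj_square[OF G edge[OF that]] .
  qed (use c adj_commute in auto)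
  also have "(\<Prod>i<?n. adj C (c ! i) (c ! (Suc i mod ?n))) =
      (\<Prod>i<?n. weight C {c ! i, c ! (Suc i mod ?n)})"
    using edge by (intro prod.cong) (auto simp: adj_def)
  also have "\<dots> = (\<Prod>e\<in>edges C. weight C e)"
    using c by (simp add: prod_cycle_edges)
  also have "\<dots> = (if balanced C then 1 else -1)"
  proof -
    have "\<bar>\<Prod>e\<in>edges C. weight C e\<bar> = 1"
      unfolding abs_prod using G by (intro prod.neutral) (auto simp: signed_graph_def)
    then show ?thesis by (auto simp: balanced_def)
  qed
  finally show ?thesis using c by (simp add: distinct_card)
qed

text \<open>With \<open>v\<close> listed first, the tail of the list is a path on one vertex fewer;
  for an odd cycle length the two halves \<open>div 2\<close> agree.\<close>

lemma set_det_signed_cycle_remove: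
  assumes "signed_cycle C" "v \<in> verts C"
  shows "set_det (verts C - {v}) (adj C) =
    (if odd (card (verts C)) then (-1) ^ (card (verts C) div 2) else 0)"
proof -
  have G: "signed_graph C" using assms by (simp add: signed_cycle_def)
  obtain c where c: "distinct c" "length c \<ge> 3" "c ! 0 = v" "verts C = set c" "edges C = cycle_edges c"
    using signed_cycle_list_from[OF assms] .
  obtain xs where xs: "c = v # xs" using c by (cases c) auto
  let ?n = "length c"
  have nth: "xs ! i = c ! Suc i" for i by (simp add: xs)
  have n: "?n = Suc (length xs)" by (simp add: xs)
  have edge: "adj C (xs ! i) (xs ! j) = 0"
    if "i < length xs" "j < length xs" "j \<noteq> Suc i" "i \<noteq> Suc j" for i j
    using that c nth n nth_doubleton_in_cycle_edges_iff[OF c(1), of "Suc i" "Suc j"]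
    by (auto simp: adj_def mod_Suc)
  have "set_det (set xs) (adj C) = (if even (length xs) then (-1) ^ (length xs div 2) else 0)"
  proof (rule set_det_path)
    show "adj C (xs ! i) (xs ! Suc i) * adj C (xs ! Suc i) (xs ! i) = 1" if "Suc i < length xs" for i
    proof -
      have "{xs ! i, xs ! Suc i} \<in> edges C"
        using that c n nth nth_doubleton_in_cycle_edges_iff[OF c(1), of "Suc i" "Suc (Suc i)"]
        by (simp add: mod_Suc)
      then show ?thesis using adj_square[OF G] by (simp add: adj_commute[of C "xs ! Suc i"])
    qed
  qed (use c xs edge in auto)
  moreover have "verts C - {v} = set xs" using c xs by auto
  moreover have "card (verts C) = Suc (length xs)" using c n by (simp add: distinct_card)
  ultimately show ?thesis by auto
qed

section \<open>The determinant of the unicyclic graph\<close>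

theorem theorem8:
  fixes C T U :: "'a sgraph" and v r :: 'a and s \<delta> :: real and n m :: nat and vs :: "'a list"
  assumes "n \<ge> 3"
    and "signed_cycle C" and "card (verts C) = n" and "v \<in> verts C"
    and "signed_tree T" and "card (verts T) = m" and "r \<in> verts T"
    and "verts C \<inter> verts T = {}"
    and "s \<in> {1, -1}"
    and "U = join_by_edge C v T r s"
    and "\<delta> = (if balanced C then 1 else -1)"
    and "distinct vs" and "set vs = verts U"
  shows
    "(even n \<and> \<not> has_perfect_matching T \<longrightarrow>
        det (adjacency_matrix vs U) = 0) \<and>
     (even n \<and> has_perfect_matching T \<longrightarrow>
        det (adjacency_matrix vs U) = (-1) ^ (m div 2) * (- 2 * \<delta> + 2 * (-1) ^ (n div 2))) \<and>
     (odd n \<and> has_perfect_matching (induced U (insert v (verts T))) \<longrightarrow>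
        det (adjacency_matrix vs U) = (-1) ^ ((m + n) div 2)) \<and>
     (odd n \<and> has_perfect_matching T \<longrightarrow>
        det (adjacency_matrix vs U) = 2 * \<delta> * (-1) ^ (m div 2))"
proof -
  let ?R = "induced T (verts T - {r})" and ?L = "induced U (insert v (verts T))"
  have C: "signed_graph C" using assms(2) by (simp add: signed_cycle_def)
  have T: "signed_graph T" "acyclic_graph T" using assms(5) by (auto simp: signed_tree_def)
  have fin: "finite (verts C)" "finite (verts T)" using C T by (auto simp: signed_graph_def)
  have sub: "\<And>e. e \<in> edges C \<Longrightarrow> e \<subseteq> verts C" "\<And>e. e \<in> edges T \<Longrightarrow> e \<subseteq> verts T"
    and two: "\<And>e. e \<in> edges C \<Longrightarrow> card e = 2" "\<And>e. e \<in> edges T \<Longrightarrow> card e = 2"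
    using C T by (auto simp: signed_graph_def)
  have disj: "x \<notin> verts T" if "x \<in> verts C" for x using that assms(8) by auto
  have vr: "v \<notin> verts T" "r \<notin> verts C" "v \<noteq> r" using assms(4,7,8) by auto
  have verts_U: "verts U = verts C \<union> verts T"
    and edges_U: "edges U = insert {v, r} (edges C \<union> edges T)"
    and weight_U: "weight U e =
      (if e = {v, r} then s else if e \<in> edges C then weight C e else weight T e)" for e
    by (auto simp: assms(10) join_by_edge_def)
  have U: "signed_graph U"
    using C T assms(4,7,9) vr by (auto simp: signed_graph_def verts_U edges_U weight_U)
  \<comment> \<open>The bridge has one end on each side and the sides are disjoint, so within one
    side the entries are those of that side.\<close>
  have adj_C: "adj U x y = adj C x y" if "x \<in> verts C" "y \<in> verts C" for x y
    using that vr sub(2)[of "{x, y}"] disj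
    by (auto simp: adj_def edges_U weight_U doubleton_eq_iff)
  have adj_T: "adj U x y = adj T x y" if "x \<in> verts T" "y \<in> verts T" for x y
    using that vr sub(1)[of "{x, y}"] disj
    by (auto simp: adj_def edges_U weight_U doubleton_eq_iff)
  have adj_cross: "adj U x y = 0 \<and> adj U y x = 0"
    if "x \<in> verts C" "y \<in> verts T" "x \<noteq> v \<or> y \<noteq> r" for x y
  proof -
    have "{x, y} \<notin> edges U"
      using that vr sub(1)[of "{x, y}"] sub(2)[of "{x, y}"] disj[of x] disj[of y]
      by (auto simp: edges_U doubleton_eq_iff)
    then show ?thesis by (simp add: adj_def insert_commute)
  qed
  \<comment> \<open>The bridge has weight 1 or -1, so its two entries multiply to 1 in the bridge
    formula.\<close>
  have "adj U v r * adj U v r = 1"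
    using U by (intro adj_square) (auto simp: edges_U)
  then have vr_unit: "adj U v r * adj U r v = 1" by (simp add: adj_commute[of U r])
  have "det (adjacency_matrix vs U) = set_det (verts C \<union> verts T) (adj U)"
    using det_adjacency_matrix[OF assms(12,13)] verts_U by simp
  also have "\<dots> = set_det (verts C) (adj U) * set_det (verts T) (adj U) -
      adj U v r * adj U r v * (set_det (verts C - {v}) (adj U) * set_det (verts T - {r}) (adj U))"
    using fin assms(4,7,8) adj_cross by (intro set_det_bridge) auto
  also have "set_det (verts C) (adj U) = set_det (verts C) (adj C)"
    using adj_C by (intro set_det_cong) auto
  also have "set_det (verts C - {v}) (adj U) = set_det (verts C - {v}) (adj C)"
    using adj_C by (intro set_det_cong) auto
  also have "set_det (verts T) (adj U) = set_det (verts T) (adj T)"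
    using adj_T by (intro set_det_cong) auto
  also have "set_det (verts T - {r}) (adj U) = set_det (verts T - {r}) (adj T)"
    using adj_T by (intro set_det_cong) auto
  also have "\<dots> = set_det (verts ?R) (adj ?R)"
    by (rule set_det_induced[symmetric]) auto
  finally have det_U: "det (adjacency_matrix vs U) =
      set_det (verts C) (adj C) * set_det (verts T) (adj T) -
      set_det (verts C - {v}) (adj C) * set_det (verts ?R) (adj ?R)"
    using vr_unit by simp
  have det_C: "set_det (verts C) (adj C) =
      2 * (-1) ^ (n - 1) * \<delta> + (if even n then 2 * (-1) ^ (n div 2) else 0)"
    using set_det_signed_cycle[OF assms(2)] assms(3,11) by simp
  have det_Cv: "set_det (verts C - {v}) (adj C) = (if odd n then (-1) ^ (n div 2) else 0)"
    using set_det_signed_cycle_remove[OF assms(2,4)] assms(3) by simp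
  have det_T: "set_det (verts T) (adj T) = (if has_perfect_matching T then (-1) ^ (m div 2) else 0)"
    and T_even: "has_perfect_matching T \<Longrightarrow> even m"
    using set_det_forest[OF T] assms(6) by auto
  have m: "m = Suc (card (verts ?R))"
  proof -
    have "verts ?R = verts T - {r}" by auto
    then show ?thesis using card_Suc_Diff1[OF fin(2) assms(7)] assms(6) by simp
  qed
  have det_R: "set_det (verts ?R) (adj ?R) =
      (if has_perfect_matching ?R then (-1) ^ (card (verts ?R) div 2) else 0)"
    and R_even: "has_perfect_matching ?R \<Longrightarrow> even (card (verts ?R))"
    using set_det_forest[OF signed_graph_induced[OF T(1)] acyclic_graph_induced[OF T(2)]] by auto
  \<comment> \<open>In \<open>{T, v}\<close> the vertex \<open>v\<close> is a leaf attached to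
    \<open>r\<close>; deleting both leaves \<open>T\<close> without its root.\<close>
  have L_R: "has_perfect_matching ?L \<longleftrightarrow> has_perfect_matching ?R"
  proof -
    have edges_L: "edges ?L = insert {v, r} (edges T)"
    proof -
      \<comment> \<open>Such an edge would lie inside \<open>{v}\<close>, but edges have two
        ends.\<close>
      have "\<not> e \<subseteq> insert v (verts T)" if "e \<in> edges C" for e
      proof
        assume "e \<subseteq> insert v (verts T)"
        then have "e \<subseteq> {v}" using sub(1)[OF that] disj by auto
        then show False using two(1)[OF that] card_mono[of "{v}" e] by simp
      qed
      then show ?thesis using sub(2) assms(7) by (auto simp: edges_U)
    qed
    have verts_L: "verts ?L = insert v (verts T)" using assms(4) by (auto simp: verts_U)
    have "has_perfect_matching ?L \<longleftrightarrow> has_perfect_matching (induced ?L (verts ?L - {v, r}))"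
    proof (rule has_perfect_matching_remove_leaf)
      show "signed_graph ?L" using U by (rule signed_graph_induced)
      show "{v, r} \<in> edges ?L" unfolding edges_L by simp
      show "e = {v, r}" if "e \<in> edges ?L" "v \<in> e" for e
        using that vr sub(2) unfolding edges_L by auto
    qed
    also have "\<dots> \<longleftrightarrow> has_perfect_matching ?R"
    proof (rule has_perfect_matching_cong)
      have L_minus: "verts ?L - {v, r} = verts T - {r}" unfolding verts_L using vr by auto
      show "verts (induced ?L (verts ?L - {v, r})) = verts ?R"
        unfolding L_minus unfolding induced_simps(1)[of ?L] verts_L by auto
      show "edges (induced ?L (verts ?L - {v, r})) = edges ?R"
        unfolding L_minus unfolding induced_simps(2)[of ?L] edges_L by auto
    qed
    finally show ?thesis .
  qed
  show ?thesis
  proof (intro conjI impI)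
    \<comment> \<open>For even \<open>n\<close> the path \<open>C - v\<close> has odd order, so the
      second product is 0; the first is 0 through the factor of \<open>T\<close>.\<close>
    assume "even n \<and> \<not> has_perfect_matching T"
    then show "det (adjacency_matrix vs U) = 0" using det_U det_T det_Cv by simp
  next
    assume "even n \<and> has_perfect_matching T"
    \<comment> \<open>Rotations of an even cycle are odd permutations, which gives the sign of
      \<open>- 2 * \<delta>\<close>.\<close>
    moreover have "odd (n - 1)" if "even n" using that assms(1) by simp
    ultimately show "det (adjacency_matrix vs U) =
        (-1) ^ (m div 2) * (- 2 * \<delta> + 2 * (-1) ^ (n div 2))"
      using det_U det_T det_Cv det_C by simp
  next
    assume odd: "odd n \<and> has_perfect_matching ?L"
    then have R: "has_perfect_matching ?R" using L_R by simp
    then have "even (card (verts ?R))" by (rule R_even)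
    then obtain a where a: "card (verts ?R) = 2 * a" by (elim evenE)
    obtain b where b: "n = 2 * b + 1" using odd by (elim conjE oddE)
    \<comment> \<open>Since \<open>T - r\<close> has even order, \<open>T\<close> has odd order and
      no perfect matching, so only the second product survives.\<close>
    have "odd m" using m a by simp
    then have "\<not> has_perfect_matching T" using T_even by blast
    then have "det (adjacency_matrix vs U) = - ((-1) ^ b * (-1) ^ a)"
      using det_U det_T det_Cv det_R R odd a b by simp
    \<comment> \<open>Both \<open>m = 2 * a + 1\<close> and \<open>n = 2 * b + 1\<close> are odd;
      the extra one in the exponent is the minus sign of the bridge formula.\<close>
    moreover have "(m + n) div 2 = Suc (b + a)" using m a b by simp
    ultimately show "det (adjacency_matrix vs U) = (-1) ^ ((m + n) div 2)"
      by (simp add: power_add)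
  next
    assume odd: "odd n \<and> has_perfect_matching T"
    \<comment> \<open>By parity the second product is 0. In the first, the swaps on an odd cycle
      contribute 0 and the rotations have sign 1.\<close>
    then have "\<not> has_perfect_matching ?R" using T_even R_even m by auto
    then show "det (adjacency_matrix vs U) = 2 * \<delta> * (-1) ^ (m div 2)"
      using det_U det_T det_C det_R odd by simp
  qed
qed

end
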